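(* The sequence of Gr\"unwald--Durrmeyer operators $\{\mathcal{D}_n\}_{n\in\mathbb{N}}$ is uniformly bounded on $C[0,\pi]$: there is a constant $C>0$ such that $\|\mathcal{D}_n(f)\|_\infty\le C\|f\|_\infty$ for all $n\in\{1,2,\dots\}$ and all $f\in C[0,\pi]$, where $\|\cdot\|_\infty$ is the supremum norm on $[0,\pi]$.
   Context: For $n=1,2,\dots$ and $k=1,\dots,n$ let $\theta_k^{(n)}=\frac{2k-1}{2n}\pi$ and \[ P_k(t)=(-1)^{k+1}\frac{\cos(nt)\,\sin\theta_k^{(n)}}{n\,(\cos t-\cos\theta_k^{(n)})},\qquad t\in\mathbb{R}, \] where the (removable) singularities are filled in by continuity ($P_k$ depends on $n$ as well). Put \[ S_{k,n}(t)=\tfrac12\left(P_k\!\left(t-\tfrac{\pi}{2n}\right)+P_k\!\left(t+\tfrac{\pi}{2n}\right)\right). \] The $n$-th Gr\"unwald--Durrmeyer operator is defined, for $f\in L^p[0,\pi]$ ($1\le p\le+\infty$, Lebesgue measure) and $\theta\in[0,\pi]$, by \[ \mathcal{D}_n(f)(\theta)=\frac{n}{\pi}\sum_{k=1}^n S_{k,n}(\theta)\int_0^\pi f(t)\,S_{k,n}(t)\,dt . \] *)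

theory Defs
  imports "HOL-Analysis.Analysis"
begin

definition cheb_node :: "nat \<Rightarrow> nat \<Rightarrow> real" where
  "cheb_node n k = (2 * real k - 1) / (2 * real n) * pi"

definition fund_quot :: "nat \<Rightarrow> nat \<Rightarrow> real \<Rightarrow> real" where
  "fund_quot n k t = (-1) ^ (k + 1) * (cos (real n * t) * sin (cheb_node n k))
     / (real n * (cos t - cos (cheb_node n k)))"

text \<open>For \<open>1 \<le> k \<le> n\<close> the zeros of the denominator of \<open>fund_quot n k\<close> are isolated,
  and they are removable singularities: \<open>cos (n * t)\<close> vanishes there too, and the
  denominator has only simple zeros. So the limit below exists.\<close>

definition fund_P :: "nat \<Rightarrow> nat \<Rightarrow> real \<Rightarrow> real" where
  "fund_P n k t =
     (if cos t = cos (cheb_node n k) then Lim (at t) (fund_quot n k) else fund_quot n k t)"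

definition grunwald_S :: "nat \<Rightarrow> nat \<Rightarrow> real \<Rightarrow> real" where
  "grunwald_S n k t =
     1 / 2 * (fund_P n k (t - pi / (2 * real n)) + fund_P n k (t + pi / (2 * real n)))"

definition grunwald_durrmeyer :: "nat \<Rightarrow> (real \<Rightarrow> real) \<Rightarrow> real \<Rightarrow> real" where
  "grunwald_durrmeyer n f \<theta> =
     real n / pi * (\<Sum>k=1..n. grunwald_S n k \<theta> * (LINT t:{0..pi}|lebesgue. f t * grunwald_S n k t))"

text \<open>The supremum norm on \<open>[0, \<pi>]\<close>. It is meaningful only for functions bounded there;
  this covers every continuous \<open>f\<close> and every \<open>grunwald_durrmeyer n f\<close>, since the
  latter is a finite linear combination of the continuous functions \<open>grunwald_S n k\<close>.\<close>

definition sup_norm :: "(real \<Rightarrow> real) \<Rightarrow> real" where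
  "sup_norm f = (SUP t\<in>{0..pi}. \<bar>f t\<bar>)"

end

theory Submission
  imports Defs
begin

text \<open>By the Christoffel--Darboux identity \<open>P\<^sub>k\<close> is the cosine polynomial
  \<open>(1 + 2 \<Sum>j<n. cos (j \<theta>\<^sub>k) cos (j t)) / n\<close>. Averaging the two shifts by \<open>h = \<pi> / (2 n)\<close>
  inserts factors \<open>cos (j h)\<close>, so \<open>S\<^sub>k(t) = (K(t - \<theta>\<^sub>k) + K(t + \<theta>\<^sub>k)) / (2 n)\<close>, where
  \<open>K(u) = 1 + 2 \<Sum>j<n. cos (j h) cos (j u)\<close> is again a Christoffel--Darboux kernel. As \<open>h\<close> is
  itself a node, \<open>K(u) = cos (n u) sin h / (cos u - cos h)\<close> decays quadratically, which gives
  \<open>\<bar>S\<^sub>k(t)\<bar> \<le> 5 / (1 + (n (t - \<theta>\<^sub>k) / \<pi>)\<^sup>2)\<close>. Hence both \<open>\<Sum>k. \<bar>S\<^sub>k(\<theta>)\<bar>\<close> and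
  \<open>n \<integral> \<bar>S\<^sub>k\<bar>\<close> are bounded uniformly in \<open>n\<close> by comparison with the arctangent.\<close>

section \<open>Cosine kernels and the Christoffel--Darboux identity\<close>

definition cos_kernel :: "nat \<Rightarrow> real \<Rightarrow> real \<Rightarrow> real" where
  "cos_kernel n a t = 1 + 2 * (\<Sum>j=1..<n. cos (real j * a) * cos (real j * t))"

lemma cos_mult_cos_Suc:
  "2 * cos x * cos (real (Suc m) * x) = cos (real (Suc (Suc m)) * x) + cos (real m * x)"
proof -
  have "cos (real (Suc (Suc m)) * x) + cos (real m * x)
      = cos (real (Suc m) * x + x) + cos (real (Suc m) * x - x)"
    by (simp add: algebra_simps)
  then show ?thesis by (simp add: cos_add cos_diff)
qed

text \<open>Induction on \<open>m\<close>: the kernel gains one product \<open>2 * (c * d)\<close>,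
  and the three-term recurrence \<open>cos_mult_cos_Suc\<close>, used at \<open>t\<close> and at
  \<open>a\<close>, gives the right-hand side the matching increment.\<close>

lemma christoffel_darboux_cos:
  "(cos t - cos a) * cos_kernel (Suc m) a t
     = cos (real (Suc m) * t) * cos (real m * a) - cos (real m * t) * cos (real (Suc m) * a)"
proof (induction m)
  case 0
  then show ?case by (simp add: cos_kernel_def)
next
  case (Suc m)
  define c where "c = cos (real (Suc m) * a)"
  define d where "d = cos (real (Suc m) * t)"
  have step: "cos_kernel (Suc (Suc m)) a t = cos_kernel (Suc m) a t + 2 * (c * d)"
    by (simp add: cos_kernel_def c_def d_def)
  have IH: "(cos t - cos a) * cos_kernel (Suc m) a t = d * cos (real m * a) - cos (real m * t) * c"
    using Suc by (simp add: c_def d_def)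
  have t: "cos (real (Suc (Suc m)) * t) = 2 * cos t * d - cos (real m * t)"
    using cos_mult_cos_Suc[of t m] by (simp add: d_def)
  have a: "cos (real (Suc (Suc m)) * a) = 2 * cos a * c - cos (real m * a)"
    using cos_mult_cos_Suc[of a m] by (simp add: c_def)
  have "(cos t - cos a) * cos_kernel (Suc (Suc m)) a t
      = (cos t - cos a) * cos_kernel (Suc m) a t + (cos t - cos a) * (2 * (c * d))"
    unfolding step by (rule distrib_left)
  also have "\<dots> = (2 * cos t * d - cos (real m * t)) * c - d * (2 * cos a * c - cos (real m * a))"
    unfolding IH by algebra
  finally show ?case
    unfolding t a c_def d_def .
qed

lemma cheb_node_bounds:
  assumes "1 \<le> k" "k \<le> n"
  shows "0 < cheb_node n k" "cheb_node n k < pi"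
proof -
  define q where "q = (2 * real k - 1) / (2 * real n)"
  have "0 < q" "q < 1"
    using assms by (simp_all add: q_def field_simps)
  then show "0 < cheb_node n k" "cheb_node n k < pi"
    unfolding cheb_node_def q_def[symmetric] by simp_all
qed

lemma cos_sin_cheb_node:
  assumes "1 \<le> k" "0 < n"
  shows "cos (real n * cheb_node n k) = 0" "sin (real n * cheb_node n k) = (-1) ^ (k + 1)"
proof -
  obtain m where m: "k = Suc m" using assms by (cases k) auto
  have "real n * cheb_node n k = real m * pi + pi / 2"
    using assms by (simp add: cheb_node_def m field_simps)
  then show "cos (real n * cheb_node n k) = 0" "sin (real n * cheb_node n k) = (-1) ^ (k + 1)"
    by (simp_all add: m cos_add sin_add)
qed

text \<open>At a node \<open>cos (n * \<theta>)\<close> vanishes, so one Christoffel--Darboux term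
  survives. Used for general \<open>k\<close> to identify \<open>fund_P\<close>, and for
  \<open>k = 1\<close> to get the decay of the kernel.\<close>

lemma cos_kernel_node:
  assumes "1 \<le> k" "0 < n"
  shows "(cos t - cos (cheb_node n k)) * cos_kernel n (cheb_node n k) t
           = (-1) ^ (k + 1) * (cos (real n * t) * sin (cheb_node n k))"
proof -
  obtain m where m: "n = Suc m" using assms by (cases n) auto
  define \<theta> where "\<theta> = cheb_node n k"
  have "cos (real m * \<theta>) = cos (real n * \<theta> - \<theta>)"
    by (simp add: m algebra_simps)
  also have "\<dots> = (-1) ^ (k + 1) * sin \<theta>"
    using cos_sin_cheb_node[OF assms] by (simp add: cos_diff \<theta>_def)
  finally show ?thesis
    using christoffel_darboux_cos[of t \<theta> m] cos_sin_cheb_node(1)[OF assms]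
    by (simp add: m[symmetric] \<theta>_def)
qed

lemma continuous_cos_kernel: "continuous_on UNIV (cos_kernel n a)"
  unfolding cos_kernel_def by (intro continuous_intros)

lemma abs_cos_kernel_le:
  assumes "0 < n"
  shows "\<bar>cos_kernel n a t\<bar> \<le> 2 * real n"
proof -
  have "\<bar>\<Sum>j=1..<n. cos (real j * a) * cos (real j * t)\<bar> \<le> (\<Sum>j=1..<n. 1)"
    by (rule order.trans[OF sum_abs sum_mono])
       (simp add: abs_mult mult_le_one)
  also have "\<dots> = real n - 1" using assms by simp
  finally show ?thesis unfolding cos_kernel_def by linarith
qed

section \<open>Kernel formulas for the fundamental polynomials and their averages\<close>

lemma fund_quot_eq_kernel:
  assumes "1 \<le> k" "k \<le> n" "cos t \<noteq> cos (cheb_node n k)"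
  shows "fund_quot n k t = cos_kernel n (cheb_node n k) t / real n"
  using cos_kernel_node[of k n t, symmetric] assms
  by (simp add: fund_quot_def field_simps)

lemma fund_P_eq_kernel:
  assumes k: "1 \<le> k" "k \<le> n"
  shows "fund_P n k t = cos_kernel n (cheb_node n k) t / real n"
proof (cases "cos t = cos (cheb_node n k)")
  case False
  then show ?thesis using fund_quot_eq_kernel[OF k] by (simp add: fund_P_def)
next
  case True
  let ?K = "\<lambda>s. cos_kernel n (cheb_node n k) s / real n"
  \<comment> \<open>The zero of \<open>cos s - cos t\<close> at \<open>s = t\<close> is simple
    because \<open>sin t\<close> is nonzero. Hence the quotient agrees with the continuous kernel on
    a punctured neighbourhood of \<open>t\<close>.\<close>
  have "sin (cheb_node n k) > 0" using cheb_node_bounds[OF k] by (simp add: sin_gt_zero)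
  moreover have "(sin t)\<^sup>2 = (sin (cheb_node n k))\<^sup>2" using True by (simp add: sin_squared_eq)
  ultimately have "sin t \<noteq> 0" by auto
  moreover have "((\<lambda>s. (cos s - cos t) / (s - t)) \<longlongrightarrow> - sin t) (at t)"
    using DERIV_cos[of t] by (simp add: has_field_derivative_iff)
  ultimately have "\<forall>\<^sub>F s in at t. (cos s - cos t) / (s - t) \<noteq> 0"
    by (intro tendsto_imp_eventually_ne[where c = "- sin t"]) auto
  then have "\<forall>\<^sub>F s in at t. ?K s = fund_quot n k s"
    by eventually_elim (use True fund_quot_eq_kernel[OF k] in auto)
  moreover have "(?K \<longlongrightarrow> ?K t) (at t)"
    using continuous_cos_kernel[of n "cheb_node n k"]
    by (auto simp: continuous_on_def divide_inverse intro!: tendsto_intros)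
  ultimately have "(fund_quot n k \<longlongrightarrow> ?K t) (at t)"
    using Lim_transform_eventually by blast
  then have "Lim (at t) (fund_quot n k) = ?K t" by (intro tendsto_Lim) auto
  with True show ?thesis by (simp add: fund_P_def)
qed

text \<open>Both sides expand to \<open>2 + 4 * (\<Sum>j=1..<n. cos (j * a) * cos (j * h) * cos (j *
  t))\<close>, which is symmetric in \<open>a\<close> and \<open>h\<close>.\<close>

lemma cos_kernel_diff_add_shift:
  "cos_kernel n a (t - h) + cos_kernel n a (t + h) = cos_kernel n h (t - a) + cos_kernel n h (t + a)"
  by (simp add: cos_kernel_def sum_distrib_left flip: sum.distrib)
     (rule sum.cong, simp_all add: cos_add cos_diff algebra_simps)

text \<open>The shift \<open>pi / (2 * n)\<close> equals \<open>cheb_node n 1\<close>, so the kernel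
  obtained by swapping shift and node again has the closed form of
  \<open>cos_kernel_node\<close>.\<close>

lemma grunwald_S_eq_kernel:
  assumes "1 \<le> k" "k \<le> n"
  shows "grunwald_S n k t = (cos_kernel n (cheb_node n 1) (t - cheb_node n k)
           + cos_kernel n (cheb_node n 1) (t + cheb_node n k)) / (2 * real n)"
  using assms cos_kernel_diff_add_shift[of n "cheb_node n k" t "cheb_node n 1"]
  by (simp add: grunwald_S_def fund_P_eq_kernel cheb_node_def add_divide_distrib[symmetric])

section \<open>Quadratic decay of the kernel and pointwise bounds\<close>

lemma cos_kernel_decay:
  assumes "0 < n"
  shows "\<bar>cos_kernel n (cheb_node n 1) u\<bar> * (1 + (real n * sin (u / 2))\<^sup>2) \<le> 5 * real n"
proof -
  define h where "h = cheb_node n 1"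
  define K where "K = \<bar>cos_kernel n h u\<bar>"
  define s where "s = (sin (u / 2))\<^sup>2"
  define a where "a = (sin (h / 2))\<^sup>2"
  have K: "0 \<le> K" "K \<le> 2 * real n"
    unfolding K_def using abs_cos_kernel_le[OF assms] by auto
  have nh: "real n * h = pi / 2" using assms by (simp add: h_def cheb_node_def)
  have h: "0 < h" "h < pi" unfolding h_def using cheb_node_bounds[of 1 n] assms by auto
  have pi: "pi < 3.2" using pi_approx by simp
  have diff: "cos u - cos h = 2 * (a - s)"
    using cos_double_sin[of "u / 2"] cos_double_sin[of "h / 2"] by (simp add: a_def s_def)
  have "K * \<bar>cos u - cos h\<bar> = \<bar>cos (real n * u)\<bar> * sin h"
    using cos_kernel_node[of 1 n u] assms h
    by (simp add: K_def h_def mult.commute sin_ge_zero flip: abs_mult)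
       (simp add: abs_mult sin_ge_zero)
  also have "\<dots> \<le> 1 * h"
    using h by (intro mult_mono) (auto simp: sin_x_le_x sin_ge_zero)
  finally have Kd: "K * \<bar>cos u - cos h\<bar> \<le> h" by simp
  have "K * (1 + (real n)\<^sup>2 * s) \<le> 5 * real n"
  \<comment> \<open>Near the zeros of \<open>cos u - cos h\<close> the closed form is useless, but
    there \<open>n * sin (u / 2)\<close> is bounded and the trivial bound \<open>2 * n\<close>
    suffices. Otherwise \<open>2 * (s - a) \<ge> s\<close>, so the closed form applies.\<close>
  proof (cases "s < 2 * a")
    case True
    have "sin (h / 2) \<le> h / 2" "0 \<le> sin (h / 2)"
      using h sin_x_le_x[of "h / 2"] by (auto intro: sin_ge_zero)
    then have "a \<le> (h / 2)\<^sup>2" unfolding a_def by (rule power_mono)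
    then have "(real n)\<^sup>2 * a \<le> (real n)\<^sup>2 * (h / 2)\<^sup>2" by (intro mult_left_mono) auto
    also have "\<dots> = (real n * h / 2)\<^sup>2" by (simp add: power_mult_distrib power_divide)
    also have "\<dots> = (pi / 4)\<^sup>2" unfolding nh by simp
    also have "\<dots> \<le> 0.8\<^sup>2" using pi by (intro power_mono) auto
    finally have na: "(real n)\<^sup>2 * a \<le> 0.64" by (simp add: power2_eq_square)
    have "(real n)\<^sup>2 * s \<le> (real n)\<^sup>2 * (2 * a)" using True by (intro mult_left_mono) auto
    with na have "1 + (real n)\<^sup>2 * s \<le> 5 / 2" by simp
    then have "K * (1 + (real n)\<^sup>2 * s) \<le> (2 * real n) * (5 / 2)"
      using K by (intro mult_mono) (auto simp: s_def)
    then show ?thesis by simp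
  next
    case False
    then have "s \<le> \<bar>cos u - cos h\<bar>" unfolding diff by (simp add: a_def)
    then have "K * s \<le> h" using Kd K mult_left_mono by (meson order.trans)
    then have "(real n)\<^sup>2 * (K * s) \<le> (real n)\<^sup>2 * h" by (intro mult_left_mono) auto
    also have "\<dots> = real n * (pi / 2)" using nh by (simp add: power2_eq_square)
    also have "\<dots> \<le> real n * 3" using pi by (intro mult_left_mono) auto
    \<comment> \<open>The summand 1 contributes at most \<open>2 * n\<close> by the trivial bound,
      the quadratic term at most \<open>3 * n\<close>.\<close>
    finally show ?thesis using K by (simp add: algebra_simps)
  qed
  then show ?thesis by (simp add: K_def h_def s_def power_mult_distrib)
qed

text \<open>Jordan's inequality: by concavity, sine lies above its chord on
  \<open>{0..pi / 2}\<close>.\<close>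

lemma abs_le_pi_mult_sin_half:
  assumes "\<bar>u\<bar> \<le> pi"
  shows "\<bar>u\<bar> \<le> pi * \<bar>sin (u / 2)\<bar>"
proof -
  have "concave_on {0..pi / 2} sin"
  proof (rule f''_le0_imp_concave[where f' = cos and f'' = "\<lambda>x. - sin x"])
    show "- sin x \<le> 0" if "x \<in> {0..pi / 2}" for x :: real
      using that by (auto intro: sin_ge_zero)
  qed (auto intro!: derivative_eq_intros)
  from concave_onD_Icc'[OF this, of "\<bar>u\<bar> / 2"] have "\<bar>u\<bar> \<le> pi * sin (\<bar>u\<bar> / 2)"
    using assms by (simp add: field_simps)
  also have "\<dots> \<le> pi * \<bar>sin (u / 2)\<bar>"
    by (intro mult_left_mono) (cases "u \<ge> 0"; simp)+
  finally show ?thesis .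
qed

lemma abs_grunwald_S_le:
  assumes k: "1 \<le> k" "k \<le> n" and t: "0 \<le> t" "t \<le> pi"
  shows "\<bar>grunwald_S n k t\<bar> \<le> 5 / (1 + (real n * (t - cheb_node n k) / pi)\<^sup>2)"
proof -
  define \<theta> where "\<theta> = cheb_node n k"
  define q where "q = 1 + (real n * (t - \<theta>) / pi)\<^sup>2"
  have \<theta>: "0 < \<theta>" "\<theta> < pi" using cheb_node_bounds[OF k] by (auto simp: \<theta>_def)
  have n: "0 < n" using k by simp
  have q: "0 < q" unfolding q_def by (simp add: add_pos_nonneg)
  have "\<bar>t - \<theta>\<bar> \<le> pi * \<bar>sin ((t - \<theta>) / 2)\<bar>"
    by (rule abs_le_pi_mult_sin_half) (use \<theta> t in auto)
  then have "\<bar>(t - \<theta>) / pi\<bar> \<le> \<bar>sin ((t - \<theta>) / 2)\<bar>" by (simp add: field_simps)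
  then have minus: "((t - \<theta>) / pi)\<^sup>2 \<le> (sin ((t - \<theta>) / 2))\<^sup>2"
    by (simp only: abs_le_square_iff)
  \<comment> \<open>Since \<open>t + \<theta>\<close> may exceed \<open>pi\<close>, Jordan's
    inequality is not applied to it directly; the reflected term is compared with the one at
    \<open>t - \<theta>\<close> instead.\<close>
  have "(sin ((t + \<theta>) / 2))\<^sup>2 - (sin ((t - \<theta>) / 2))\<^sup>2 = sin t * sin \<theta>"
  proof -
    have "cos (t + \<theta>) = 1 - 2 * (sin ((t + \<theta>) / 2))\<^sup>2" "cos (t - \<theta>) = 1 - 2 * (sin ((t - \<theta>) / 2))\<^sup>2"
      using cos_double_sin[of "(t + \<theta>) / 2"] cos_double_sin[of "(t - \<theta>) / 2"]
      by (simp_all only: mult_2 field_sum_of_halves)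
    then show ?thesis by (simp add: cos_add cos_diff)
  qed
  also have "\<dots> \<ge> 0" using \<theta> t by (simp add: sin_ge_zero)
  finally have plus: "((t - \<theta>) / pi)\<^sup>2 \<le> (sin ((t + \<theta>) / 2))\<^sup>2" using minus by simp
  have bound: "\<bar>cos_kernel n (cheb_node n 1) u\<bar> \<le> 5 * real n / q"
    if "((t - \<theta>) / pi)\<^sup>2 \<le> (sin (u / 2))\<^sup>2" for u
  proof -
    have "q \<le> 1 + (real n * sin (u / 2))\<^sup>2"
      using mult_left_mono[OF that, of "(real n)\<^sup>2"]
      by (simp add: q_def power_mult_distrib power_divide)
    then have "\<bar>cos_kernel n (cheb_node n 1) u\<bar> * q \<le> 5 * real n"
      using cos_kernel_decay[OF n, of u] by (meson abs_ge_zero mult_left_mono order.trans)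
    then show ?thesis using q by (simp add: field_simps)
  qed
  have "\<bar>grunwald_S n k t\<bar> \<le> (5 * real n / q + 5 * real n / q) / (2 * real n)"
    unfolding grunwald_S_eq_kernel[OF k] \<theta>_def[symmetric] abs_divide
    using bound[OF minus] bound[OF plus] abs_triangle_ineq n
    by (intro frac_le) (auto intro: order.trans[OF abs_triangle_ineq add_mono])
  also have "\<dots> = 5 / q" using n by (simp add: field_simps)
  finally show ?thesis by (simp add: q_def \<theta>_def)
qed

section \<open>Sums and integrals compared with the arctangent\<close>

lemma inverse_one_plus_square_le_arctan_diff:
  "1 / (1 + x\<^sup>2) \<le> 3 * (arctan (x + 1) - arctan (x::real))"
proof -
  obtain z where z: "x < z" "z < x + 1" "arctan (x + 1) - arctan x = (x + 1 - x) * inverse (1 + z\<^sup>2)"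
    using MVT2[of x "x + 1" arctan "\<lambda>z. inverse (1 + z\<^sup>2)"] DERIV_arctan by auto
  have "(z - x)\<^sup>2 \<le> 1" using z by (simp add: power_le_one)
  \<comment> \<open>This square is the slack in
    \<open>(x + y)\<^sup>2 \<le> 2 * x\<^sup>2 + 2 * y\<^sup>2\<close> with
    \<open>y = z - x\<close>.\<close>
  moreover have "0 \<le> (x - (z - x))\<^sup>2" by simp
  ultimately have "z\<^sup>2 \<le> 2 + 2 * x\<^sup>2"
    by (simp add: power2_eq_square algebra_simps)
  then have "1 + z\<^sup>2 \<le> 3 * (1 + x\<^sup>2) - x\<^sup>2" by simp
  also have "\<dots> \<le> 3 * (1 + x\<^sup>2)" by simp
  finally have "1 + z\<^sup>2 \<le> 3 * (1 + x\<^sup>2)" .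
  moreover have "0 < 1 + z\<^sup>2" "0 < 1 + x\<^sup>2" by (simp_all add: add_pos_nonneg)
  ultimately show ?thesis unfolding z(3) by (simp add: field_simps)
qed

lemma sum_inverse_one_plus_square_le:
  "(\<Sum>k=1..n. 1 / (1 + (x - real k)\<^sup>2)) \<le> 3 * pi"
proof -
  have "(\<Sum>k=1..n. 1 / (1 + (x - real k)\<^sup>2))
      \<le> (\<Sum>k=1..n. 3 * (arctan (x - real k + 1) - arctan (x - real k)))"
    by (intro sum_mono inverse_one_plus_square_le_arctan_diff)
  also have "\<dots> = 3 * (arctan x - arctan (x - real n))"
    by (induction n) (simp_all add: algebra_simps)
  also have "\<dots> \<le> 3 * pi"
    using arctan_lbound[of "x - real n"] arctan_ubound[of x] by simp
  finally show ?thesis .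
qed

lemma sum_abs_grunwald_S_le:
  assumes t: "0 \<le> t" "t \<le> pi"
  shows "(\<Sum>k=1..n. \<bar>grunwald_S n k t\<bar>) \<le> 15 * pi"
proof -
  \<comment> \<open>The nodes have spacing \<open>pi / n\<close>, so after rescaling the distances
    become unit steps and the arctangent differences telescope.\<close>
  have eq: "real n * (t - cheb_node n k) / pi = (real n * t / pi + 1 / 2) - real k"
    if "k \<in> {1..n}" for k
    using that by (simp add: cheb_node_def field_simps)
  have "(\<Sum>k=1..n. \<bar>grunwald_S n k t\<bar>)
      \<le> (\<Sum>k=1..n. 5 * (1 / (1 + ((real n * t / pi + 1 / 2) - real k)\<^sup>2)))"
  proof (rule sum_mono)
    fix k assume k: "k \<in> {1..n}"
    then show "\<bar>grunwald_S n k t\<bar> \<le> 5 * (1 / (1 + ((real n * t / pi + 1 / 2) - real k)\<^sup>2))"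
      using abs_grunwald_S_le[of k n t] t unfolding eq[OF k] by simp
  qed
  also have "\<dots> \<le> 5 * (3 * pi)"
    unfolding sum_distrib_left[symmetric]
    by (intro mult_left_mono sum_inverse_one_plus_square_le) simp
  finally show ?thesis by simp
qed

lemma has_integral_cauchy_density:
  fixes c d a b :: real
  assumes "0 < c" "a \<le> b"
  shows "((\<lambda>t. 1 / (1 + (c * (t - d))\<^sup>2)) has_integral
           (arctan (c * (b - d)) - arctan (c * (a - d))) / c) {a..b}"
proof -
  have "((\<lambda>t. arctan (c * (t - d)) / c) has_real_derivative 1 / (1 + (c * (t - d))\<^sup>2)) (at t within {a..b})"
    for t
    using assms by (auto intro!: derivative_eq_intros simp: divide_inverse)
  then show ?thesis
    using fundamental_theorem_of_calculus[OF assms(2), of "\<lambda>t. arctan (c * (t - d)) / c"]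
    by (simp add: has_real_derivative_iff_has_vector_derivative diff_divide_distrib)
qed

lemma abs_integral_mult_grunwald_S_le:
  assumes k: "1 \<le> k" "k \<le> n" and f: "\<And>t. t \<in> {0..pi} \<Longrightarrow> \<bar>f t\<bar> \<le> M" and M: "0 \<le> M"
  shows "\<bar>LINT t:{0..pi}|lebesgue. f t * grunwald_S n k t\<bar> \<le> 5 * M * pi\<^sup>2 / real n"
proof -
  define c where "c = real n / pi"
  define d where "d = cheb_node n k"
  define g where "g = (\<lambda>t. 5 * M * (1 / (1 + (c * (t - d))\<^sup>2)))"
  have c: "0 < c" using k by (simp add: c_def)
  have nz: "1 + x\<^sup>2 \<noteq> 0" for x :: real by (metis add_pos_nonneg less_irrefl zero_le_power2 zero_less_one)
  have int: "set_integrable lebesgue {0..pi} g"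
    unfolding g_def by (intro absolutely_integrable_continuous_real continuous_intros) (use nz in auto)
  have g0: "0 \<le> g t" for t unfolding g_def using M by (simp add: add_nonneg_nonneg)
  have le: "\<bar>f t * grunwald_S n k t\<bar> \<le> g t" if t: "t \<in> {0..pi}" for t
  proof -
    have "\<bar>f t * grunwald_S n k t\<bar> \<le> M * (5 / (1 + (real n * (t - d) / pi)\<^sup>2))"
      unfolding abs_mult d_def using f[OF t] abs_grunwald_S_le[OF k] t M by (intro mult_mono) auto
    then show ?thesis by (simp add: g_def c_def mult.commute)
  qed
  have "\<bar>LINT t:{0..pi}|lebesgue. f t * grunwald_S n k t\<bar>
      \<le> (LINT t|lebesgue. \<bar>indicator {0..pi} t *\<^sub>R (f t * grunwald_S n k t)\<bar>)"
    unfolding set_lebesgue_integral_def by (rule integral_abs_bound)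
  also have "\<dots> \<le> (LINT t:{0..pi}|lebesgue. g t)"
    \<comment> \<open>Integrability is checked for the majorant \<open>g\<close> alone: a
      non-integrable integrand has integral 0 by convention, and \<open>g\<close> is
      nonnegative.\<close>
    unfolding set_lebesgue_integral_def using int le g0
    by (intro integral_mono') (auto simp: set_integrable_def indicator_def)
  also have "\<dots> = integral {0..pi} g"
    by (rule set_lebesgue_integral_eq_integral(2)[OF int])
  also have "\<dots> = 5 * M * ((arctan (c * (pi - d)) - arctan (c * (0 - d))) / c)"
    unfolding g_def
    by (intro integral_unique has_integral_mult_right has_integral_cauchy_density c) simp
  also have "\<dots> \<le> 5 * M * (pi / c)"
    using arctan_lbound[of "c * (0 - d)"] arctan_ubound[of "c * (pi - d)"] M c
    by (intro mult_left_mono divide_right_mono) auto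
  finally show ?thesis by (simp add: c_def power2_eq_square mult.assoc)
qed

section \<open>Uniform boundedness of the operators\<close>

lemma abs_le_sup_norm:
  assumes "continuous_on {0..pi} f" "t \<in> {0..pi}"
  shows "\<bar>f t\<bar> \<le> sup_norm f"
proof -
  have "compact ((\<lambda>t. \<bar>f t\<bar>) ` {0..pi})"
    using assms by (intro compact_continuous_image continuous_intros) auto
  then show ?thesis
    unfolding sup_norm_def
    by (intro cSUP_upper assms(2) bounded_imp_bdd_above compact_imp_bounded)
qed

theorem lemma3p1:
  "\<exists>C::real. C > 0 \<and>
     (\<forall>n::nat. n \<ge> 1 \<longrightarrow>
       (\<forall>f::real \<Rightarrow> real. continuous_on {0..pi} f \<longrightarrow>
          sup_norm (grunwald_durrmeyer n f) \<le> C * sup_norm f))"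
proof (intro exI[of _ "75 * pi\<^sup>2"] conjI allI impI)
  \<comment> \<open>The constant is \<open>(n / pi) * (15 * pi) * (5 * pi\<^sup>2 / n)\<close>: the
    prefactor, the bound for the sum of the \<open>\<bar>grunwald_S n k \<theta>\<bar>\<close>, and
    the bound for each integral.\<close>
  show "0 < 75 * pi\<^sup>2" by simp
next
  fix n :: nat and f :: "real \<Rightarrow> real"
  assume n: "1 \<le> n" and f: "continuous_on {0..pi} f"
  define M where "M = sup_norm f"
  have M: "0 \<le> M" using abs_le_sup_norm[OF f, of 0] by (simp add: M_def)
  let ?I = "\<lambda>k. LINT t:{0..pi}|lebesgue. f t * grunwald_S n k t"
  have "\<bar>grunwald_durrmeyer n f \<theta>\<bar> \<le> 75 * pi\<^sup>2 * M" if \<theta>: "\<theta> \<in> {0..pi}" for \<theta>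
  proof -
    have "\<bar>\<Sum>k=1..n. grunwald_S n k \<theta> * ?I k\<bar>
        \<le> (\<Sum>k=1..n. \<bar>grunwald_S n k \<theta>\<bar> * (5 * M * pi\<^sup>2 / real n))"
    proof (intro order.trans[OF sum_abs sum_mono])
      fix k assume "k \<in> {1..n}"
      then have "\<bar>?I k\<bar> \<le> 5 * M * pi\<^sup>2 / real n"
        using abs_le_sup_norm[OF f] M by (intro abs_integral_mult_grunwald_S_le) (auto simp: M_def)
      then show "\<bar>grunwald_S n k \<theta> * ?I k\<bar> \<le> \<bar>grunwald_S n k \<theta>\<bar> * (5 * M * pi\<^sup>2 / real n)"
        unfolding abs_mult by (rule mult_left_mono) simp
    qed
    also have "\<dots> \<le> 15 * pi * (5 * M * pi\<^sup>2 / real n)"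
      unfolding sum_distrib_right[symmetric]
      using sum_abs_grunwald_S_le[of \<theta> n] \<theta> M by (intro mult_right_mono) auto
    finally have "real n / pi * \<bar>\<Sum>k=1..n. grunwald_S n k \<theta> * ?I k\<bar>
        \<le> real n / pi * (15 * pi * (5 * M * pi\<^sup>2 / real n))"
      by (intro mult_left_mono) auto
    then show ?thesis using n by (simp add: grunwald_durrmeyer_def abs_mult mult_ac)
  qed
  then show "sup_norm (grunwald_durrmeyer n f) \<le> 75 * pi\<^sup>2 * sup_norm f"
    unfolding M_def sup_norm_def[of "grunwald_durrmeyer n f"] by (intro cSUP_least) auto
qed

end
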